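(* Let $\mathbb{F}$ be a field with $\operatorname{char}(\mathbb{F})\neq 2$, and let $\mathcal{A}$ be a unital finite-dimensional (not necessarily associative) $\mathbb{F}$-algebra. Then $l(\mathcal{A})=1$ if and only if there is a special basis $\{1_{\mathcal{A}},a_2,\ldots,a_n\}$ of $\mathcal{A}$.
   Context: Algebras are unital with identity $1_{\mathcal{A}}$ and not necessarily associative. For a finite subset $S\subseteq\mathcal{A}$, a word in $S$ is any product (with any bracketing) of finitely many elements of $S$; its length is the number of letters different from $1_{\mathcal{A}}$ in the product; $1_{\mathcal{A}}$ is by convention a word of length $0$ in any $S$. $\mathcal{L}_i(S)$ is the $\mathbb{F}$-span of all words in $S$ of length at most $i$, and $\mathrm{alg}(S)=\bigcup_{i\ge 0}\mathcal{L}_i(S)$ is the subalgebra generated by $S$ (it contains $1_{\mathcal{A}}$). The length of $S$ is $l(S)=\min\{k\in\mathbb{Z}_{\ge 0}:\mathrm{alg}(S)=\mathcal{L}_k(S)\}$, and $l(\mathcal{A})=\max\{l(S): S \text{ finite},\ \mathrm{alg}(S)=\mathcal{A}\}$. A basis $\{1_{\mathcal{A}},a_2,\ldots,a_n\}$ of $\mathcal{A}$ is canonical if for each $2\le i\le n$ there is $\mu_i\in\mathbb{F}$ with $a_i^2=\mu_i 1_{\mathcal{A}}$. A canonical basis is special if there are scalars $\beta_i\in\mathbb{F}$ ($2\le i\le n$) and $\alpha_{ij}\in\mathbb{F}$ ($2\le i\ne j\le n$) such that $a_ia_j=\alpha_{ij}1_{\mathcal{A}}+\beta_j a_i-\beta_i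 a_j$ for all $2\le i\neq j\le n$. *)

theory Defs
  imports Complex_Main
begin

text \<open>A word before evaluation: a product of letters together with its bracketing.\<close>

datatype (letters: 'a) bracketed_word =
    Letter 'a
  | Prod "'a bracketed_word" "'a bracketed_word"

text \<open>
  A unital, not necessarily associative algebra over a field, carried by a whole type.
  The library's algebra classes are associative, so the multiplication and the identity are
  explicit parameters.
\<close>

locale unital_algebra = vector_space scale
  for scale :: "'f::field \<Rightarrow> 'a::ab_group_add \<Rightarrow> 'a" (infixr \<open>*s\<close> 75) +
  fixes mul :: "'a \<Rightarrow> 'a \<Rightarrow> 'a" (infixl \<open>\<bullet>\<close> 70)
    and one :: 'a (\<open>\<one>\<close>)
  assumes mul_add_left: "(x + y) \<bullet> z = x \<bullet> z + y \<bullet> z"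
    and mul_add_right: "x \<bullet> (y + z) = x \<bullet> y + x \<bullet> z"
    and mul_scale_left: "(c *s x) \<bullet> y = c *s (x \<bullet> y)"
    and mul_scale_right: "x \<bullet> (c *s y) = c *s (x \<bullet> y)"
    and one_mul: "\<one> \<bullet> x = x"
    and mul_one: "x \<bullet> \<one> = x"
begin

primrec word_value :: "'a bracketed_word \<Rightarrow> 'a" where
  "word_value (Letter s) = s"
| "word_value (Prod u v) = word_value u \<bullet> word_value v"

primrec word_length :: "'a bracketed_word \<Rightarrow> nat" where
  "word_length (Letter s) = (if s = \<one> then 0 else 1)"
| "word_length (Prod u v) = word_length u + word_length v"

text \<open>
  \<open>words_upto S i\<close> consists of the values of the words in \<open>S\<close> of length at most \<open>i\<close>; by
  convention \<open>\<one>\<close> is a word of length 0 in every \<open>S\<close>, also when \<open>\<one> \<notin> S\<close> or \<open>S = {}\<close>.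
\<close>

definition words_upto :: "'a set \<Rightarrow> nat \<Rightarrow> 'a set" where
  "words_upto S i = insert \<one> {word_value w | w. letters w \<subseteq> S \<and> word_length w \<le> i}"

definition lin_span :: "nat \<Rightarrow> 'a set \<Rightarrow> 'a set" where
  "lin_span i S = span (words_upto S i)"

definition alg :: "'a set \<Rightarrow> 'a set" where
  "alg S = (\<Union>i. lin_span i S)"

text \<open>
  In finite dimension the increasing chain \<open>lin_span i S\<close> stabilizes at \<open>alg S\<close>, so the least
  element exists.
\<close>

definition set_length :: "'a set \<Rightarrow> nat" where
  "set_length S = (LEAST k. alg S = lin_span k S)"

text \<open>
  In finite dimension the maximum is over a nonempty finite set of numbers: a basis is a finite
  generating set, and if \<open>lin_span k S = lin_span (2 * k) S\<close> with \<open>k \<ge> 1\<close> then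
  \<open>lin_span k S = alg S\<close> (a word of length greater than \<open>k\<close> has a subword of length between
  \<open>k + 1\<close> and \<open>2 * k\<close>, which can be replaced by shorter ones), so the lengths are bounded in
  terms of the dimension.
\<close>

definition algebra_length :: nat where
  "algebra_length = Max {set_length S | S. finite S \<and> alg S = UNIV}"

text \<open>
  A basis \<open>{\<one>, a\<^sub>2, \<dots>, a\<^sub>n}\<close> is encoded by \<open>n\<close> and a function \<open>a\<close> of which only the values on
  \<open>{1..n}\<close> matter; \<open>a 1\<close> is the identity.
\<close>

definition unital_basis :: "nat \<Rightarrow> (nat \<Rightarrow> 'a) \<Rightarrow> bool" where
  "unital_basis n a \<longleftrightarrow> 1 \<le> n \<and> a 1 = \<one> \<and> inj_on a {1..n} \<and>
     independent (a ` {1..n}) \<and> span (a ` {1..n}) = UNIV"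

definition canonical_basis :: "nat \<Rightarrow> (nat \<Rightarrow> 'a) \<Rightarrow> bool" where
  "canonical_basis n a \<longleftrightarrow> unital_basis n a \<and> (\<forall>i\<in>{2..n}. \<exists>\<mu>. a i \<bullet> a i = \<mu> *s \<one>)"

definition special_basis :: "nat \<Rightarrow> (nat \<Rightarrow> 'a) \<Rightarrow> bool" where
  "special_basis n a \<longleftrightarrow> canonical_basis n a \<and>
     (\<exists>(\<beta> :: nat \<Rightarrow> 'f) (\<alpha> :: nat \<Rightarrow> nat \<Rightarrow> 'f). \<forall>i\<in>{2..n}. \<forall>j\<in>{2..n}. i \<noteq> j \<longrightarrow>
        a i \<bullet> a j = \<alpha> i j *s \<one> + \<beta> j *s a i - \<beta> i *s a j)"

end

end

theory Submission
  imports Defs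
begin

text \<open>
  Both sides of the equivalence say that the algebra is more than the multiples of the identity and
  that multiplying two elements never leads out of the span of these two and the identity:
  \<open>x \<bullet> y \<in> span {\<one>, x, y}\<close> for all \<open>x\<close> and \<open>y\<close>.

  Length one means that every finite generating set spans the algebra once the identity is added
  (\<open>lin_span_one\<close>). If products stay in \<open>span {\<one>, x, y}\<close>, then the span of a generating set and
  the identity is already a subalgebra, hence everything. Conversely, if some \<open>x \<bullet> y\<close> lies outside
  \<open>span {\<one>, x, y}\<close>, then some basis contains \<open>x \<bullet> y\<close> and has \<open>\<one>\<close>, \<open>x\<close> and \<open>y\<close> in the span of its
  other members. These other members generate \<open>x \<bullet> y\<close>, hence the whole algebra, but do not span it:
  a generating set of length at least two (\<open>mul_mem_span_if_generators_span\<close>). The maximum that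
  defines the length of the algebra exists because a subspace \<open>lin_span m S\<close> that equals
  \<open>lin_span (2 * m) S\<close> is a subalgebra, so the chain \<open>lin_span (2 ^ k) S\<close> grows by at least one
  dimension at each step until it reaches \<open>alg S\<close> (\<open>alg_eq_lin_span_dim\<close>).

  Given a special basis, \<open>x \<bullet> y\<close> is, up to a multiple of \<open>\<one>\<close>, a combination of \<open>x\<close> and \<open>y\<close>
  whose coefficients are linear functionals of \<open>y\<close> and of \<open>x\<close>. This is a bilinear statement, so
  it suffices to see it on the basis (\<open>special_basis_mul_mem_span\<close>). Conversely, if products stay in
  \<open>span {\<one>, x, y}\<close>, every element satisfies a quadratic equation, and completing the square
  turns any basis containing \<open>\<one>\<close> into a canonical one. Write
  \<open>a\<^sub>i \<bullet> a\<^sub>j = \<alpha>\<^sub>i\<^sub>j \<one> + p\<^sub>i\<^sub>j a\<^sub>i + q\<^sub>i\<^sub>j a\<^sub>j\<close>. The squares of \<open>a\<^sub>i + a\<^sub>j\<close> and \<open>a\<^sub>i - a\<^sub>j\<close> force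
  \<open>q\<^sub>j\<^sub>i = - p\<^sub>i\<^sub>j\<close>, and the product \<open>(a\<^sub>i + a\<^sub>k) \<bullet> a\<^sub>j\<close> forces \<open>p\<^sub>i\<^sub>j = p\<^sub>k\<^sub>j\<close>, so that \<open>p\<^sub>i\<^sub>j\<close> is a
  scalar \<open>\<beta>\<^sub>j\<close> depending on \<open>j\<close> only (\<open>canonical_basis_is_special\<close>).
\<close>

context unital_algebra
begin

section \<open>Words and generated subalgebras\<close>

lemma zero_mul: "0 \<bullet> y = 0"
  using mul_scale_left[of 0 0 y] by simp

lemma mul_zero: "x \<bullet> 0 = 0"
  using mul_scale_right[of x 0 0] by simp

lemma minus_mul: "(- x) \<bullet> y = - (x \<bullet> y)"
  using mul_scale_left[of "-1" x y] by simp

lemma mul_minus: "x \<bullet> (- y) = - (x \<bullet> y)"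
  using mul_scale_right[of x "-1" y] by simp

lemma diff_mul: "(x - y) \<bullet> z = x \<bullet> z - y \<bullet> z"
  using mul_add_left[of x "- y" z] by (simp add: minus_mul)

lemma mul_diff: "x \<bullet> (y - z) = x \<bullet> y - x \<bullet> z"
  using mul_add_right[of x y "- z"] by (simp add: mul_minus)

lemma mul_mem_span:
  assumes UW: "\<And>u w. u \<in> U \<Longrightarrow> w \<in> W \<Longrightarrow> u \<bullet> w \<in> span X"
    and x: "x \<in> span U" and y: "y \<in> span W"
  shows "x \<bullet> y \<in> span X"
  using x
proof (induction rule: span_induct)
  case base
  show ?case
    by (auto simp: subspace_def zero_mul mul_add_left mul_scale_left
        intro: span_zero span_add span_scale)
next
  case (step u)
  show ?case
    using y
  proof (induction rule: span_induct)
    case base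
    show ?case
      by (auto simp: subspace_def mul_zero mul_add_right mul_scale_right
          intro: span_zero span_add span_scale)
  next
    case (step w)
    then show ?case using UW \<open>u \<in> U\<close> by blast
  qed
qed

lemma words_upto_mono: "i \<le> j \<Longrightarrow> words_upto S i \<subseteq> words_upto S j"
  by (auto simp: words_upto_def)

lemma lin_span_mono: "i \<le> j \<Longrightarrow> lin_span i S \<subseteq> lin_span j S"
  unfolding lin_span_def by (intro span_mono words_upto_mono)

lemma lin_span_subset_alg: "lin_span i S \<subseteq> alg S"
  by (auto simp: alg_def)

lemma words_upto_mul:
  assumes "u \<in> words_upto S i" "v \<in> words_upto S j"
  shows "u \<bullet> v \<in> words_upto S (i + j)"
proof (cases "u = \<one> \<or> v = \<one>")
  case True
  have "words_upto S i \<subseteq> words_upto S (i + j)" "words_upto S j \<subseteq> words_upto S (i + j)"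
    by (simp_all add: words_upto_mono)
  with True assms show ?thesis by (auto simp: one_mul mul_one)
next
  case False
  with assms obtain s t where
    s: "u = word_value s" "letters s \<subseteq> S" "word_length s \<le> i" and
    t: "v = word_value t" "letters t \<subseteq> S" "word_length t \<le> j"
    by (auto simp: words_upto_def)
  then have "u \<bullet> v = word_value (Prod s t)" "letters (Prod s t) \<subseteq> S"
    "word_length (Prod s t) \<le> i + j"
    by auto
  then show ?thesis unfolding words_upto_def by blast
qed

lemma lin_span_mul:
  "x \<in> lin_span i S \<Longrightarrow> y \<in> lin_span j S \<Longrightarrow> x \<bullet> y \<in> lin_span (i + j) S"
  unfolding lin_span_def by (rule mul_mem_span) (auto intro: span_base words_upto_mul)

lemma word_value_length_0: "word_length w = 0 \<Longrightarrow> word_value w = \<one>"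
  by (induction w) (auto simp: one_mul split: if_splits)

lemma word_value_length_1:
  "letters w \<subseteq> S \<Longrightarrow> word_length w \<le> 1 \<Longrightarrow> word_value w \<in> insert \<one> S"
proof (induction w)
  case (Letter s)
  then show ?case by auto
next
  case (Prod u v)
  then have u: "word_length u \<le> 1 \<Longrightarrow> word_value u \<in> insert \<one> S"
    and v: "word_length v \<le> 1 \<Longrightarrow> word_value v \<in> insert \<one> S"
    by simp_all
  have "word_length u + word_length v \<le> 1" using Prod.prems by simp
  then consider "word_length u = 0" "word_length v \<le> 1" | "word_length v = 0" "word_length u \<le> 1"
    by linarith
  then show ?case
    using u v by cases (simp_all add: word_value_length_0 one_mul mul_one)
qed

lemma lin_span_zero: "lin_span 0 S = span {\<one>}"
proof -
  have "words_upto S 0 = {\<one>}"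
    by (auto simp: words_upto_def word_value_length_0)
  then show ?thesis by (simp add: lin_span_def)
qed

lemma lin_span_one: "lin_span 1 S = span (insert \<one> S)"
proof -
  have "s \<in> words_upto S 1" if "s \<in> S" for s
  proof -
    have "s = word_value (Letter s)" "letters (Letter s) \<subseteq> S" "word_length (Letter s) \<le> 1"
      using that by auto
    then show ?thesis unfolding words_upto_def by blast
  qed
  moreover have "words_upto S 1 \<subseteq> insert \<one> S"
    using word_value_length_1 by (auto simp: words_upto_def)
  moreover have "\<one> \<in> words_upto S 1"
    by (simp add: words_upto_def)
  ultimately have "words_upto S 1 = insert \<one> S" by blast
  then show ?thesis by (simp add: lin_span_def)
qed

lemma generators_subset_alg: "insert \<one> S \<subseteq> alg S"
  using span_superset[of "insert \<one> S"] lin_span_subset_alg[of 1 S] lin_span_one by blast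

lemma subspace_alg: "subspace (alg S)"
proof (rule subspaceI)
  show "0 \<in> alg S" by (auto simp: alg_def lin_span_def intro: span_zero)
next
  fix x y assume "x \<in> alg S" "y \<in> alg S"
  then obtain i j where "x \<in> lin_span i S" "y \<in> lin_span j S"
    by (auto simp: alg_def)
  then have "x \<in> lin_span (max i j) S" "y \<in> lin_span (max i j) S"
    using lin_span_mono[of i "max i j" S] lin_span_mono[of j "max i j" S] by auto
  then have "x + y \<in> lin_span (max i j) S"
    by (simp add: lin_span_def span_add)
  then show "x + y \<in> alg S" by (auto simp: alg_def)
next
  fix c x assume "x \<in> alg S"
  then show "c *s x \<in> alg S"
    by (auto simp: alg_def lin_span_def intro: span_scale)
qed

lemma alg_mul: "x \<in> alg S \<Longrightarrow> y \<in> alg S \<Longrightarrow> x \<bullet> y \<in> alg S"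
  by (auto simp: alg_def intro: lin_span_mul)

lemma alg_minimal:
  assumes V: "subspace V" and gen: "insert \<one> S \<subseteq> V"
    and mul: "\<And>x y. x \<in> V \<Longrightarrow> y \<in> V \<Longrightarrow> x \<bullet> y \<in> V"
  shows "alg S \<subseteq> V"
proof -
  have "letters w \<subseteq> S \<Longrightarrow> word_value w \<in> V" for w
    by (induction w) (use gen mul in auto)
  then have "words_upto S i \<subseteq> V" for i
    using gen by (auto simp: words_upto_def)
  then have "lin_span i S \<subseteq> V" for i
    unfolding lin_span_def using V by (intro span_minimal) auto
  then show ?thesis by (auto simp: alg_def)
qed

lemma alg_eq_UNIV_if_span: "span S = UNIV \<Longrightarrow> alg S = UNIV"
  using span_minimal[OF _ subspace_alg, of S S] generators_subset_alg[of S] by auto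

text \<open>
  Doubling the length bound is what one multiplication costs, so a term of the chain that survives
  doubling is a subalgebra.
\<close>

lemma alg_eq_lin_span_if_doubling_stable:
  assumes stable: "lin_span (2 * m) S = lin_span m S" and "1 \<le> m"
  shows "alg S = lin_span m S"
proof
  show "alg S \<subseteq> lin_span m S"
  proof (rule alg_minimal)
    show "subspace (lin_span m S)" by (simp add: lin_span_def)
    show "insert \<one> S \<subseteq> lin_span m S"
      using span_superset[of "insert \<one> S"] lin_span_mono[OF \<open>1 \<le> m\<close>] lin_span_one by blast
    show "x \<bullet> y \<in> lin_span m S" if "x \<in> lin_span m S" "y \<in> lin_span m S" for x y
      using lin_span_mul[OF that] stable by (simp add: mult_2)
  qed
qed (rule lin_span_subset_alg)

lemma mem_span_triple:
  "v \<in> span {u, x, y} \<longleftrightarrow> (\<exists>a b c. v = a *s u + b *s x + c *s y)"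
proof -
  have "v \<in> span {u, x, y} \<longleftrightarrow> (\<exists>a b c. v - a *s u - b *s x - c *s y = 0)"
    by (simp add: span_breakdown_eq)
  also have "\<dots> \<longleftrightarrow> (\<exists>a b c. v = a *s u + b *s x + c *s y)"
    by (simp only: diff_eq_eq add_0 add.commute add.left_commute)
  finally show ?thesis .
qed

section \<open>Special bases and products in the span of the factors\<close>

text \<open>
  Prescribing the values of a linear functional on a basis: with values 0 and 1 this gives the
  coordinates, which turn equations between vectors into equations between scalars.
\<close>

lemma linear_functional_on_unital_basis:
  assumes "unital_basis n a"
  obtains g where "module_hom scale (*) g" "\<And>i. i \<in> {1..n} \<Longrightarrow> g (a i) = c i"
proof
  define I where "I = {1..n}"
  define D where "D = a ` I"
  define g where "g v = (\<Sum>i\<in>I. c i * representation D v (a i))" for v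
  have D: "independent D" "span D = UNIV" "inj_on a I" and fin: "finite I"
    using assms by (auto simp: unital_basis_def D_def I_def)
  have "g (x + y) = g x + g y" for x y
    by (simp add: g_def representation_add D distrib_left sum.distrib)
  moreover have "g (k *s x) = k * g x" for k x
    by (simp add: g_def representation_scale D sum_distrib_left mult.left_commute)
  moreover have "module ((*) :: 'f \<Rightarrow> 'f \<Rightarrow> 'f)"
    by unfold_locales (simp_all add: algebra_simps)
  ultimately show "module_hom scale (*) g"
    by (simp add: module_hom_iff module_axioms)
  show "g (a i) = c i" if "i \<in> {1..n}" for i
  proof -
    have i: "i \<in> I" using that by (simp add: I_def)
    have "c j * representation D (a i) (a j) = (if j = i then c i else 0)" if "j \<in> I" for j
      using that i D by (auto simp: representation_basis inj_on_eq_iff D_def)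
    then have "g (a i) = (\<Sum>j\<in>I. if j = i then c i else 0)"
      unfolding g_def by (intro sum.cong) auto
    then show ?thesis using i fin by simp
  qed
qed

lemma unital_basis_span_one:
  assumes "unital_basis n a" "2 \<le> n"
  shows "span {\<one>} \<noteq> UNIV"
proof
  assume "span {\<one>} = UNIV"
  then have "a 2 \<in> range (\<lambda>k. k *s \<one>)" by (simp add: span_singleton)
  then obtain k where k: "a 2 = k *s \<one>" by blast
  obtain g where "module_hom scale (*) g"
    and "\<And>i. i \<in> {1..n} \<Longrightarrow> g (a i) = (if i = 2 then 1 else 0)"
    by (rule linear_functional_on_unital_basis[OF assms(1), of "\<lambda>i. if i = 2 then 1 else 0"]) blast
  then have g: "g (k *s \<one>) = k * g \<one>" "g (a 2) = 1" "g (a 1) = 0"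
    using assms(2) by (simp_all add: module_hom.scale)
  have "a 1 = \<one>" using assms by (simp add: unital_basis_def)
  with g k show False by simp
qed

text \<open>
  On \<open>a\<^sub>2, \<dots>, a\<^sub>n\<close> the rule for products reads \<open>x \<bullet> y = \<beta>(y) x - \<beta>(x) y\<close> up to multiples of \<open>\<one>\<close>,
  with \<open>\<beta>\<close> extended linearly; it covers the squares as well, where the two terms cancel. To
  include the identity itself, whose products are \<open>\<one> \<bullet> y = y\<close> and \<open>x \<bullet> \<one> = x\<close>, two extensions
  are used: \<open>g\<close> takes the value 1 at \<open>\<one>\<close> and \<open>h\<close> the value \<open>-1\<close>, so that
  \<open>x \<bullet> y = g(y) x - h(x) y\<close> up to multiples of \<open>\<one>\<close> without exception.
\<close>

lemma special_basis_mul_mem_span: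
  assumes "special_basis n a"
  shows "x \<bullet> y \<in> span {\<one>, x, y}"
proof -
  have basis: "unital_basis n a"
    and sq: "\<And>i. i \<in> {2..n} \<Longrightarrow> \<exists>\<mu>. a i \<bullet> a i = \<mu> *s \<one>"
    using assms by (auto simp: special_basis_def canonical_basis_def)
  then have a1: "a 1 = \<one>" and spn: "span (a ` {1..n}) = UNIV"
    by (auto simp: unital_basis_def)
  obtain \<beta> \<alpha> where prod: "\<And>i j. i \<in> {2..n} \<Longrightarrow> j \<in> {2..n} \<Longrightarrow> i \<noteq> j \<Longrightarrow>
      a i \<bullet> a j = \<alpha> i j *s \<one> + \<beta> j *s a i - \<beta> i *s a j"
    using assms unfolding special_basis_def by blast
  obtain g where g_hom: "module_hom scale (*) g"
    and g: "\<And>i. i \<in> {1..n} \<Longrightarrow> g (a i) = (if i = 1 then 1 else \<beta> i)"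
    by (rule linear_functional_on_unital_basis[OF basis, of "\<lambda>i. if i = 1 then 1 else \<beta> i"]) blast
  obtain h where h_hom: "module_hom scale (*) h"
    and h: "\<And>i. i \<in> {1..n} \<Longrightarrow> h (a i) = (if i = 1 then - 1 else \<beta> i)"
    by (rule linear_functional_on_unital_basis[OF basis, of "\<lambda>i. if i = 1 then - 1 else \<beta> i"]) blast
  note linear = g_hom[THEN module_hom.add] g_hom[THEN module_hom.scale] g_hom[THEN module_hom.zero]
    h_hom[THEN module_hom.add] h_hom[THEN module_hom.scale] h_hom[THEN module_hom.zero]
  define T where "T x y = x \<bullet> y - g y *s x + h x *s y" for x y
  have T_add: "T (x + x') y = T x y + T x' y" "T x (y + y') = T x y + T x y'" for x x' y y'
    by (simp_all add: T_def linear mul_add_left mul_add_right algebra_simps)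
  have T_scale: "T (c *s x) y = c *s T x y" "T x (c *s y) = c *s T x y" for c x y
    by (simp_all add: T_def linear mul_scale_left mul_scale_right algebra_simps)
  have T_zero: "T 0 y = 0" "T x 0 = 0" for x y
    by (simp_all add: T_def linear zero_mul mul_zero)
  have T_basis: "T (a i) (a j) \<in> span {\<one>}" if i: "i \<in> {1..n}" and j: "j \<in> {1..n}" for i j
  proof -
    consider "i = 1" | "j = 1" | "i \<in> {2..n}" "i = j" | "i \<in> {2..n}" "j \<in> {2..n}" "i \<noteq> j"
      using i j by fastforce
    then show ?thesis
    proof cases
      case 1
      then show ?thesis
        using i h[of 1] a1 by (simp add: T_def one_mul span_neg span_scale span_base)
    next
      case 2
      then show ?thesis
        using j g[of 1] a1 by (simp add: T_def mul_one span_scale span_base)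
    next
      case 3
      then have "g (a i) = h (a i)" using g h by simp
      then have "T (a i) (a j) = a i \<bullet> a i" using \<open>i = j\<close> by (simp add: T_def)
      then show ?thesis using sq[OF 3(1)] by (auto simp: span_scale span_base)
    next
      case 4
      then have "T (a i) (a j) = \<alpha> i j *s \<one>"
        using prod[OF 4] g[of j] h[of i] by (simp add: T_def)
      then show ?thesis by (simp add: span_scale span_base)
    qed
  qed
  have "T x y \<in> span {\<one>}"
  proof -
    have "x \<in> span (a ` {1..n})" "y \<in> span (a ` {1..n})" using spn by auto
    then show ?thesis
    proof (induction x rule: span_induct)
      case base
      show ?case
        by (auto simp: subspace_def T_zero T_add T_scale intro: span_zero span_add span_scale)
    next
      case (step x)
      from \<open>y \<in> span (a ` {1..n})\<close> show ?case
      proof (induction y rule: span_induct)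
        case base
        show ?case
          by (auto simp: subspace_def T_zero T_add T_scale intro: span_zero span_add span_scale)
      next
        case (step y)
        with \<open>x \<in> a ` {1..n}\<close> show ?case using T_basis by auto
      qed
    qed
  qed
  then obtain k where k: "T x y = k *s \<one>"
    by (auto simp: span_singleton)
  have "x \<bullet> y = T x y + g y *s x + (- h x) *s y"
    by (simp add: T_def algebra_simps)
  with k have "x \<bullet> y = k *s \<one> + g y *s x + (- h x) *s y" by simp
  then show ?thesis unfolding mem_span_triple by blast
qed

text \<open>
  All coefficients are read off by coordinate functionals. In characteristic 2 the comparison of
  \<open>a\<^sub>i + a\<^sub>j\<close> with \<open>a\<^sub>i - a\<^sub>j\<close> would be empty.
\<close>

lemma canonical_basis_is_special:
  assumes two: "(2::'f) \<noteq> 0"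
    and mul_span: "\<And>x y. x \<bullet> y \<in> span {\<one>, x, y}"
    and can: "canonical_basis n a"
  shows "special_basis n a"
proof -
  have basis: "unital_basis n a" and "\<forall>i\<in>{2..n}. \<exists>\<mu>. a i \<bullet> a i = \<mu> *s \<one>"
    using can by (auto simp: canonical_basis_def)
  then obtain \<mu> where sq: "\<And>i. i \<in> {2..n} \<Longrightarrow> a i \<bullet> a i = \<mu> i *s \<one>"
    by metis
  have a1: "a 1 = \<one>" and n: "1 \<le> n" using basis by (auto simp: unital_basis_def)
  have "\<forall>i j. \<exists>\<alpha> p q. a i \<bullet> a j = \<alpha> *s \<one> + p *s a i + q *s a j"
    using mul_span mem_span_triple by blast
  then obtain \<alpha> p q where prod: "\<And>i j. a i \<bullet> a j = \<alpha> i j *s \<one> + p i j *s a i + q i j *s a j"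
    by metis
  have "\<exists>g. module_hom scale (*) g \<and> (\<forall>i\<in>{1..n}. g (a i) = (if i = k then 1 else 0))" for k
    by (rule linear_functional_on_unital_basis[OF basis, of "\<lambda>i. if i = k then 1 else 0"]) blast
  then obtain crd where crd_hom: "\<And>k. module_hom scale (*) (crd k)"
    and crd: "\<And>k i. i \<in> {1..n} \<Longrightarrow> crd k (a i) = (if i = k then 1 else 0)"
    by metis
  note linear = crd_hom[THEN module_hom.add] crd_hom[THEN module_hom.diff]
    crd_hom[THEN module_hom.scale]
  have crd_basis: "crd k (a i) = (if i = k then 1 else 0)" if "i \<in> {2..n}" for k i
    using crd[of i k] that by simp
  have crd_one: "crd k \<one> = 0" if "k \<in> {2..n}" for k
    using crd[of 1 k] n that a1 by simp
  have q: "q j i = - p i j" if ij: "i \<in> {2..n}" "j \<in> {2..n}" "i \<noteq> j" for i j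
  proof -
    note rules = linear ij(1,2)[THEN crd_one] ij(1,2)[THEN crd_basis] ij(3) ij(3)[symmetric]
    obtain s t t0 where plus: "(a i + a j) \<bullet> (a i + a j) = s *s \<one> + t *s (a i + a j) + t0 *s (a i + a j)"
      using mul_span mem_span_triple by blast
    obtain s' t' t0' where minus: "(a i - a j) \<bullet> (a i - a j) = s' *s \<one> + t' *s (a i - a j) + t0' *s (a i - a j)"
      using mul_span mem_span_triple by blast
    have "(a i + a j) \<bullet> (a i + a j) = a i \<bullet> a i + a i \<bullet> a j + (a j \<bullet> a i + a j \<bullet> a j)"
      by (simp add: mul_add_left mul_add_right algebra_simps)
    then have plus': "\<mu> i *s \<one> + (\<alpha> i j *s \<one> + p i j *s a i + q i j *s a j) +
        ((\<alpha> j i *s \<one> + p j i *s a j + q j i *s a i) + \<mu> j *s \<one>)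
        = s *s \<one> + t *s (a i + a j) + t0 *s (a i + a j)"
      using plus sq ij prod[of i j] prod[of j i] by simp
    have "(a i - a j) \<bullet> (a i - a j) = a i \<bullet> a i - a i \<bullet> a j - (a j \<bullet> a i - a j \<bullet> a j)"
      by (simp add: diff_mul mul_diff algebra_simps)
    then have minus': "\<mu> i *s \<one> - (\<alpha> i j *s \<one> + p i j *s a i + q i j *s a j) -
        ((\<alpha> j i *s \<one> + p j i *s a j + q j i *s a i) - \<mu> j *s \<one>)
        = s' *s \<one> + t' *s (a i - a j) + t0' *s (a i - a j)"
      using minus sq ij prod[of i j] prod[of j i] by simp
    have e1: "p i j + q j i = t + t0"
      using arg_cong[OF plus', of "crd i"] by (simp add: rules)
    have e2: "q i j + p j i = t + t0"
      using arg_cong[OF plus', of "crd j"] by (simp add: rules)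
    have e3: "- p i j - q j i = t' + t0'"
      using arg_cong[OF minus', of "crd i"] by (simp add: rules)
    have e4: "- q i j - p j i = - t' - t0'"
      using arg_cong[OF minus', of "crd j"] by (simp add: rules)
    have "p i j + q j i = q i j + p j i" unfolding e1 e2 ..
    also have "\<dots> = - (- q i j - p j i)" by simp
    also have "\<dots> = - p i j - q j i" unfolding e3 e4 by simp
    finally have "p i j + q j i = - (p i j + q j i)" by simp
    then have "2 * (p i j + q j i) = 0" by (simp only: mult_2 eq_neg_iff_add_eq_0)
    then have "p i j + q j i = 0" using two by (simp only: mult_eq_0_iff simp_thms)
    then show ?thesis by (simp add: eq_neg_iff_add_eq_0 add.commute)
  qed
  have p: "p i j = p k j"
    if ikj: "i \<in> {2..n}" "k \<in> {2..n}" "j \<in> {2..n}" "i \<noteq> j" "k \<noteq> j" for i k j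
  proof (cases "i = k")
    case False
    note rules = linear ikj(1-3)[THEN crd_one] ikj(1-3)[THEN crd_basis]
      ikj(4,5) ikj(4,5)[symmetric] False False[symmetric]
    obtain s t u where "(a i + a k) \<bullet> a j = s *s \<one> + t *s (a i + a k) + u *s a j"
      using mul_span mem_span_triple by blast
    then have eq: "(\<alpha> i j *s \<one> + p i j *s a i + q i j *s a j) +
        (\<alpha> k j *s \<one> + p k j *s a k + q k j *s a j)
        = s *s \<one> + t *s (a i + a k) + u *s a j"
      using prod[of i j] prod[of k j] by (simp add: mul_add_left)
    have "p i j = t" using arg_cong[OF eq, of "crd i"] by (simp add: rules)
    moreover have "p k j = t" using arg_cong[OF eq, of "crd k"] by (simp add: rules)
    ultimately show ?thesis by simp
  qed simp
  \<comment> \<open>The row used to read off \<open>\<beta> j\<close> only has to differ from \<open>j\<close>; for \<open>n = 2\<close> there is no such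
    row in the basis, but then there are no products to describe either.\<close>
  define \<beta> where "\<beta> j = p (if j = 2 then 3 else 2) j" for j
  have p_beta: "p i j = \<beta> j" if "i \<in> {2..n}" "j \<in> {2..n}" "i \<noteq> j" for i j
  proof -
    have "(if j = 2 then 3 else 2) \<in> {2..n}" using that by auto
    then show ?thesis unfolding \<beta>_def using that by (intro p) auto
  qed
  have "a i \<bullet> a j = \<alpha> i j *s \<one> + \<beta> j *s a i - \<beta> i *s a j"
    if "i \<in> {2..n}" "j \<in> {2..n}" "i \<noteq> j" for i j
    using prod[of i j] p_beta[OF that] q[of j i] p_beta[of j i] that by simp
  then show ?thesis
    unfolding special_basis_def using can by blast
qed

end

section \<open>Finite dimension\<close>

locale finite_dimensional_unital_algebra =
  unital_algebra scale mul one + finite_dimensional_vector_space scale Basis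
  for scale :: "'f::field \<Rightarrow> 'a::ab_group_add \<Rightarrow> 'a" (infixr \<open>*s\<close> 75)
    and mul :: "'a \<Rightarrow> 'a \<Rightarrow> 'a" (infixl \<open>\<bullet>\<close> 70)
    and one :: 'a (\<open>\<one>\<close>)
    and Basis :: "'a set"
begin

text \<open>Completing the square: here \<open>x\<^sup>2 \<in> span {\<one>, x}\<close>, and shifting \<open>x\<close> removes the linear term.\<close>

lemma shifted_square_scalar:
  assumes two: "(2::'f) \<noteq> 0" and mul_span: "\<And>x y. x \<bullet> y \<in> span {\<one>, x, y}"
  shows "\<exists>k \<mu>. (x - k *s \<one>) \<bullet> (x - k *s \<one>) = \<mu> *s \<one>"
proof -
  obtain s t t' where "x \<bullet> x = s *s \<one> + t *s x + t' *s x"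
    using mul_span[of x x] unfolding mem_span_triple by blast
  then have xx: "x \<bullet> x = s *s \<one> + (t + t') *s x" by (simp add: scale_left_distrib)
  define k where "k = (t + t') / 2"
  have "t + t' = 2 * k" using two by (simp add: k_def)
  then have k: "t + t' = k + k" by (simp only: mult_2)
  have sq: "x \<bullet> x = s *s \<one> + k *s x + k *s x"
    unfolding xx k by (simp only: scale_left_distrib add.assoc)
  have "(x - k *s \<one>) \<bullet> (x - k *s \<one>) = x \<bullet> x - k *s x - (k *s x - k *s k *s \<one>)"
    by (simp only: diff_mul mul_diff mul_scale_left mul_scale_right one_mul mul_one
        scale_right_diff_distrib)
  also have "\<dots> = (s + k * k) *s \<one>"
    by (simp add: sq scale_left_distrib)
  finally have "(x - k *s \<one>) \<bullet> (x - k *s \<one>) = (s + k * k) *s \<one>" .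
  then show ?thesis by blast
qed

lemma unital_basis_exists:
  assumes "span {\<one>} \<noteq> UNIV"
  obtains n b where "2 \<le> n" "n = dim (UNIV :: 'a set)" "b 1 = \<one>" "span (b ` {1..n}) = UNIV"
proof -
  have "\<one> \<noteq> 0"
  proof
    assume "\<one> = 0"
    then have zero: "x = 0" for x :: 'a using one_mul[of x] by (simp add: zero_mul)
    have "x \<in> span {\<one>}" for x by (subst zero[of x]) (rule span_zero)
    then show False using assms by blast
  qed
  then have "independent {\<one>}" by simp
  then obtain D where D: "{\<one>} \<subseteq> D" "independent D" "UNIV \<subseteq> span D"
    using maximal_independent_subset_extend[of "{\<one>}" UNIV] by auto
  then have fin: "finite D" using finiteI_independent by blast
  define m where "m = card (D - {\<one>})"
  obtain f where f: "bij_betw f {1..m} (D - {\<one>})"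
    using ex_bij_betw_nat_finite_1[of "D - {\<one>}"] fin unfolding m_def by auto
  define b where "b i = (if i = 1 then \<one> else f (i - 1))" for i :: nat
  have img: "b ` {1..Suc m} = D"
  proof -
    have "b ` {1..Suc m} = b ` insert 1 (Suc ` {1..m})"
      by (rule arg_cong[where f = "image b"]) (auto simp: image_Suc_atLeastAtMost)
    also have "\<dots> = insert (b 1) (b ` Suc ` {1..m})" by (rule image_insert)
    also have "b ` Suc ` {1..m} = f ` {1..m}"
      unfolding image_image by (intro image_cong) (auto simp: b_def)
    also have "f ` {1..m} = D - {\<one>}" using f by (simp add: bij_betw_def)
    also have "b 1 = \<one>" by (simp add: b_def)
    also have "insert \<one> (D - {\<one>}) = D" using D(1) by auto
    finally show ?thesis .
  qed
  have "D \<noteq> {\<one>}" using D(3) assms by auto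
  then have "D - {\<one>} \<noteq> {}" using D(1) by blast
  then have "m \<noteq> 0" using fin unfolding m_def by (simp only: card_eq_0_iff finite_Diff simp_thms)
  have "card D = Suc m"
    unfolding m_def using card_Suc_Diff1[OF fin, of \<one>] D(1) by simp
  moreover have "dim (UNIV :: 'a set) = card D"
    using D by (intro dim_unique[of D]) auto
  ultimately show thesis
    using \<open>m \<noteq> 0\<close> img D(3) by (intro that[of "Suc m" b]) (auto simp: b_def)
qed

lemma special_basis_exists:
  assumes two: "(2::'f) \<noteq> 0" and mul_span: "\<And>x y. x \<bullet> y \<in> span {\<one>, x, y}"
    and proper: "span {\<one>} \<noteq> UNIV"
  shows "\<exists>n a. 2 \<le> n \<and> special_basis n a"
proof -
  obtain n b where n: "2 \<le> n" "n = dim (UNIV :: 'a set)"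
    and b: "b 1 = \<one>" "span (b ` {1..n}) = UNIV"
    using unital_basis_exists[OF proper] by metis
  obtain k \<mu> where k: "\<And>x. (x - k x *s \<one>) \<bullet> (x - k x *s \<one>) = \<mu> x *s \<one>"
    using shifted_square_scalar[OF two mul_span] by metis
  define a where "a i = (if i = 1 then \<one> else b i - k (b i) *s \<one>)" for i :: nat
  have one_a: "\<one> \<in> span (a ` {1..n})"
    using n by (intro span_base) (auto simp: a_def image_iff intro!: bexI[of _ 1])
  have "b i \<in> span (a ` {1..n})" if i: "i \<in> {1..n}" for i
  proof (cases "i = 1")
    case False
    then have "b i = a i + k (b i) *s \<one>" by (simp add: a_def)
    moreover have "a i \<in> span (a ` {1..n})" using i by (intro span_base) auto
    ultimately show ?thesis using one_a by (metis span_add span_scale)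
  qed (use one_a b in simp)
  then have "span (b ` {1..n}) \<subseteq> span (a ` {1..n})"
    by (intro span_minimal) auto
  then have spn: "span (a ` {1..n}) = UNIV" using b by auto
  \<comment> \<open>A spanning family with as many members as the dimension is a basis.\<close>
  have "dim (UNIV :: 'a set) \<le> card (a ` {1..n})"
    using spn by (intro span_card_ge_dim) auto
  then have card: "card (a ` {1..n}) = n"
    using card_image_le[of "{1..n}" a] n by simp
  then have "inj_on a {1..n}" by (intro eq_card_imp_inj_on) auto
  moreover have "independent (a ` {1..n})"
    using spn card n by (intro card_le_dim_spanning[of _ UNIV]) auto
  ultimately have "unital_basis n a"
    using n spn by (simp add: unital_basis_def a_def)
  moreover have "\<forall>i\<in>{2..n}. \<exists>\<mu>. a i \<bullet> a i = \<mu> *s \<one>"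
    using k by (auto simp: a_def)
  ultimately have "canonical_basis n a" by (simp add: canonical_basis_def)
  then show ?thesis
    using canonical_basis_is_special[OF two mul_span] n by blast
qed

text \<open>
  The bound does not depend on \<open>S\<close>, so the lengths of the generating sets have a maximum.
\<close>

lemma alg_eq_lin_span_dim: "alg S = lin_span (2 ^ dim (UNIV :: 'a set)) S"
proof -
  let ?N = "dim (UNIV :: 'a set)"
  have "\<exists>k\<le>?N. lin_span (2 * 2 ^ k) S = lin_span (2 ^ k) S"
  proof (rule ccontr)
    assume grows: "\<not> ?thesis"
    have "k \<le> dim (lin_span (2 ^ k) S)" if "k \<le> Suc ?N" for k
      using that
    proof (induction k)
      case (Suc k)
      have sub: "lin_span (2 ^ k) S \<subseteq> lin_span (2 ^ Suc k) S"
        by (rule lin_span_mono) simp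
      have "\<not> dim (lin_span (2 ^ k) S) \<ge> dim (lin_span (2 ^ Suc k) S)"
      proof
        assume "dim (lin_span (2 ^ k) S) \<ge> dim (lin_span (2 ^ Suc k) S)"
        then have "lin_span (2 ^ k) S = lin_span (2 ^ Suc k) S"
          using sub by (intro subspace_dim_equal) (auto simp: lin_span_def)
        then show False using grows Suc.prems by auto
      qed
      with Suc show ?case by simp
    qed simp
    then have "Suc ?N \<le> dim (lin_span (2 ^ Suc ?N) S)" by blast
    moreover have "dim (lin_span (2 ^ Suc ?N) S) \<le> ?N" by (rule dim_subset) simp
    ultimately show False by simp
  qed
  then obtain k where "k \<le> ?N" and "lin_span (2 * 2 ^ k) S = lin_span (2 ^ k) S" by blast
  then have "alg S = lin_span (2 ^ k) S"
    by (intro alg_eq_lin_span_if_doubling_stable) auto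
  moreover have "lin_span (2 ^ k) S \<subseteq> lin_span (2 ^ ?N) S"
    using \<open>k \<le> ?N\<close> by (intro lin_span_mono) simp
  ultimately show ?thesis using lin_span_subset_alg by blast
qed

lemma set_length_le: "set_length S \<le> 2 ^ dim (UNIV :: 'a set)"
  unfolding set_length_def by (rule Least_le) (rule alg_eq_lin_span_dim)

lemma alg_eq_lin_span_set_length: "alg S = lin_span (set_length S) S"
  unfolding set_length_def by (rule LeastI) (rule alg_eq_lin_span_dim)

lemma set_length_le_iff: "set_length S \<le> k \<longleftrightarrow> alg S = lin_span k S"
proof
  assume "set_length S \<le> k"
  then show "alg S = lin_span k S"
    using lin_span_mono[of "set_length S" k S] lin_span_subset_alg[of k S]
      alg_eq_lin_span_set_length[of S] by auto
next
  assume "alg S = lin_span k S"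
  then show "set_length S \<le> k" unfolding set_length_def by (rule Least_le)
qed

text \<open>
  A product outside \<open>span {\<one>, x, y}\<close> can be made a member of a basis that is dispensable for
  generating the algebra, though not for spanning it.
\<close>

lemma mul_mem_span_if_generators_span:
  assumes gen: "\<And>S. finite S \<Longrightarrow> alg S = UNIV \<Longrightarrow> span (insert \<one> S) = UNIV"
  shows "x \<bullet> y \<in> span {\<one>, x, y}"
proof (rule ccontr)
  assume out: "x \<bullet> y \<notin> span {\<one>, x, y}"
  obtain C where C: "C \<subseteq> {\<one>, x, y}" "independent C" "{\<one>, x, y} \<subseteq> span C"
    using maximal_independent_subset[of "{\<one>, x, y}"] by metis
  have "x \<bullet> y \<notin> span C" using out span_mono[OF C(1)] by blast
  then have "independent (insert (x \<bullet> y) C)"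
    using C(2) by (simp add: independent_insertI)
  then obtain D where D: "insert (x \<bullet> y) C \<subseteq> D" "independent D" "UNIV \<subseteq> span D"
    using maximal_independent_subset_extend[of "insert (x \<bullet> y) C" UNIV] by auto
  define S where "S = D - {x \<bullet> y}"
  have "finite S" using finiteI_independent[OF D(2)] by (simp add: S_def)
  have "C \<subseteq> S" using D(1) \<open>x \<bullet> y \<notin> span C\<close> span_base[of _ C] by (auto simp: S_def)
  then have in_S: "{\<one>, x, y} \<subseteq> span S" using C(3) span_mono by blast
  have "span S \<subseteq> alg S"
    using span_minimal[OF _ subspace_alg, of S S] generators_subset_alg[of S] by auto
  then have "x \<bullet> y \<in> alg S" using in_S by (intro alg_mul) auto
  then have "D \<subseteq> alg S" using generators_subset_alg[of S] by (auto simp: S_def)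
  then have "alg S = UNIV"
    using span_minimal[OF _ subspace_alg, of D S] D(3) by auto
  then have "span (insert \<one> S) = UNIV" using gen \<open>finite S\<close> by blast
  moreover have "span (insert \<one> S) = span S" using in_S by (intro span_redundant) auto
  moreover have "x \<bullet> y \<notin> span S"
    using D(1,2) by (auto simp: S_def dependent_def)
  ultimately show False by blast
qed

lemma set_length_le_one_if_mul_mem_span:
  assumes mul_span: "\<And>x y. x \<bullet> y \<in> span {\<one>, x, y}"
  shows "set_length S \<le> 1"
proof -
  have "alg S \<subseteq> span (insert \<one> S)"
  proof (rule alg_minimal)
    show "insert \<one> S \<subseteq> span (insert \<one> S)" by (rule span_superset)
    fix x y assume "x \<in> span (insert \<one> S)" "y \<in> span (insert \<one> S)"
    then have "{\<one>, x, y} \<subseteq> span (insert \<one> S)" by (auto intro: span_base)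
    then have "span {\<one>, x, y} \<subseteq> span (insert \<one> S)" by (intro span_minimal) auto
    then show "x \<bullet> y \<in> span (insert \<one> S)" using mul_span by blast
  qed auto
  then show ?thesis
    unfolding set_length_le_iff using lin_span_subset_alg[of 1 S] lin_span_one[of S] by auto
qed

text \<open>
  The first condition bounds the length by one, the second excludes length zero, which belongs to
  the algebras generated by the empty set.
\<close>

theorem algebra_length_eq_1_iff:
  "algebra_length = 1 \<longleftrightarrow> (\<forall>x y. x \<bullet> y \<in> span {\<one>, x, y}) \<and> span {\<one>} \<noteq> UNIV"
proof -
  let ?L = "{set_length S | S. finite S \<and> alg S = UNIV}"
  have fin: "finite ?L"
  proof (rule finite_subset)
    show "?L \<subseteq> {..2 ^ dim (UNIV :: 'a set)}" using set_length_le by blast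
  qed simp
  have Basis: "alg Basis = UNIV" by (rule alg_eq_UNIV_if_span) (rule span_Basis)
  have Basis_L: "set_length Basis \<in> ?L" using Basis finite_Basis by blast
  have zero: "set_length S = 0 \<longleftrightarrow> span {\<one>} = UNIV" if "alg S = UNIV" for S
    using set_length_le_iff[of S 0] that lin_span_zero[of S] by auto
  show ?thesis
  proof
    assume "algebra_length = 1"
    then have max: "Max ?L = 1" by (simp add: algebra_length_def)
    have "span (insert \<one> S) = UNIV" if "finite S" "alg S = UNIV" for S
    proof -
      have "set_length S \<le> Max ?L" using that by (intro Max_ge[OF fin]) blast
      then show ?thesis
        using max that set_length_le_iff[of S 1] lin_span_one[of S] by simp
    qed
    then have "\<forall>x y. x \<bullet> y \<in> span {\<one>, x, y}"
      using mul_mem_span_if_generators_span by blast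
    moreover have "Max ?L \<in> ?L" using fin Basis_L by (intro Max_in) blast+
    then have "1 \<in> ?L" unfolding max .
    then obtain S where "alg S = UNIV" "set_length S = 1" by auto
    then have "span {\<one>} \<noteq> UNIV" using zero[of S] by simp
    ultimately show "(\<forall>x y. x \<bullet> y \<in> span {\<one>, x, y}) \<and> span {\<one>} \<noteq> UNIV" by blast
  next
    assume A: "(\<forall>x y. x \<bullet> y \<in> span {\<one>, x, y}) \<and> span {\<one>} \<noteq> UNIV"
    then have le: "set_length S \<le> 1" for S
      using set_length_le_one_if_mul_mem_span by blast
    moreover have "set_length Basis \<noteq> 0" using A zero[OF Basis] by blast
    ultimately have "set_length Basis = 1" by (simp add: le_antisym Suc_le_eq)
    then have "1 \<in> ?L" using Basis_L by simp
    then have "Max ?L = 1" using fin le by (intro Max_eqI) auto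
    then show "algebra_length = 1" by (simp add: algebra_length_def)
  qed
qed

end

section \<open>Algebras of length one\<close>

theorem theorem3p8:
  fixes scale :: "'f::field \<Rightarrow> 'a::ab_group_add \<Rightarrow> 'a"
    and mul :: "'a \<Rightarrow> 'a \<Rightarrow> 'a"
    and one :: 'a
    and B :: "'a set"
  assumes char_ne_2: "CHAR('f) \<noteq> 2"
    and algebra: "unital_algebra scale mul one"
    and finite_dim: "finite_dimensional_vector_space scale B"
  shows "unital_algebra.algebra_length scale mul one = 1 \<longleftrightarrow>
    (\<exists>n a. 2 \<le> n \<and> unital_algebra.special_basis scale mul one n a)"
proof -
  interpret unital_algebra scale mul one by (rule algebra)
  interpret finite_dimensional_vector_space scale B by (rule finite_dim)
  interpret finite_dimensional_unital_algebra scale mul one B ..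
  have two: "(2::'f) \<noteq> 0"
  proof
    assume "(2::'f) = 0"
    then have "CHAR('f) dvd 2" by (simp flip: of_nat_eq_0_iff_char_dvd)
    then have "CHAR('f) \<le> 2" "CHAR('f) \<noteq> 0"
      by (auto dest: dvd_imp_le intro!: Nat.gr0I)
    then have "CHAR('f) = 1" using char_ne_2 by linarith
    then show False by simp
  qed
  show ?thesis
  proof
    assume "algebra_length = 1"
    then show "\<exists>n a. 2 \<le> n \<and> special_basis n a"
      unfolding algebra_length_eq_1_iff using special_basis_exists[OF two] by blast
  next
    assume "\<exists>n a. 2 \<le> n \<and> special_basis n a"
    then obtain n a where "2 \<le> n" and special: "special_basis n a" by blast
    then have "span {one} \<noteq> UNIV"
      using unital_basis_span_one by (auto simp: special_basis_def canonical_basis_def)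
    then show "algebra_length = 1"
      unfolding algebra_length_eq_1_iff using special_basis_mul_mem_span[OF special] by blast
  qed
qed

end
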